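(* Let $(S,+)$ be a commutative cancellative semigroup with no identity element such that its difference group $S-S$ carries a multiplication making it an integral domain. Then $\mathcal{J}_p=\{p\in\beta S:\text{every }X\in p\text{ is a }J_p\text{-set in }S\}$ is a compact (two-sided) ideal of $(\beta S,+)$.
   Context: $S-S=\{a-b:a,b\in S\}$ is the difference group of $S$ (with $(a-b)+b=a$), containing $S$. $\mathbb{P}$ denotes the set of integral polynomials on $S-S$: polynomial functions $S-S\to S-S$ in one variable with coefficients in $S-S$ and zero constant term. $\mathcal{P}_f(X)$ denotes the set of nonempty finite subsets of $X$, ${}^{\mathbb{N}}S$ the set of sequences $g:\mathbb{N}\to S$, $\mathbb{N}=\{1,2,\dots\}$. For $R\in\mathcal{P}_f(\mathbb{P})$, $L\in\mathcal{P}_f({}^{\mathbb{N}}S)$, $a\in S$, $H\in\mathcal{P}_f(\mathbb{N})$, let $S_{R,L}(a,H)=\{a+f(\sum_{t\in H}g(t)): f\in R, g\in L\}$. $A\subseteq S$ is a $J_p$-set if for every $R\in\mathcal{P}_f(\mathbb{P})$ and $L\in\mathcal{P}_f({}^{\mathbb{N}}S)$ there are $a\in S$, $H\in\mathcal{P}_f(\mathbb{N})$ with $S_{R,L}(a,H)\subseteq A$. $\beta S$ is the Stone–Čech compactification of discrete $S$ (ultrafilters on $S$), with basic open sets $\overline{A}=\{p: A\in p\}$ and operation extended by: $A\in p+q$ iff $\{x\in S: -x+A\in q\}\in p$, where $-x+A=\{s: x+s\in A\}$. An ideal is a subset $I$ with $p+q,q+p\in I$ for all $p\in I$, $q\in\beta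 S$. *)

theory Defs
  imports "HOL-Analysis.Analysis" "HOL-Computational_Algebra.Polynomial"
begin

text \<open>The semigroup S is represented as a subset of an integral domain 'a which is
  its difference group S - S.\<close>

definition diff_set :: "'a::ab_group_add set \<Rightarrow> 'a set" where
  "diff_set S = {a - b | a b. a \<in> S \<and> b \<in> S}"

definition integral_polys :: "'a::idom poly set" where
  "integral_polys = {f. coeff f 0 = 0}"

definition seqs_in :: "'a set \<Rightarrow> (nat \<Rightarrow> 'a) set" where
  "seqs_in S = {g. \<forall>t\<ge>1. g t \<in> S}"

definition SRL :: "'a::idom poly set \<Rightarrow> (nat \<Rightarrow> 'a) set \<Rightarrow> 'a \<Rightarrow> nat set \<Rightarrow> 'a set" where
  "SRL R L a H = {a + poly f (\<Sum>t\<in>H. g t) | f g. f \<in> R \<and> g \<in> L}"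

definition Jp_set :: "'a::idom set \<Rightarrow> 'a set \<Rightarrow> bool" where
  "Jp_set S A \<longleftrightarrow> A \<subseteq> S \<and>
     (\<forall>R L. finite R \<and> R \<noteq> {} \<and> R \<subseteq> integral_polys \<and>
            finite L \<and> L \<noteq> {} \<and> L \<subseteq> seqs_in S \<longrightarrow>
        (\<exists>a\<in>S. \<exists>H. finite H \<and> H \<noteq> {} \<and> H \<subseteq> {1..} \<and> SRL R L a H \<subseteq> A))"

definition ultrafilter_on :: "'a set \<Rightarrow> 'a set set \<Rightarrow> bool" where
  "ultrafilter_on S p \<longleftrightarrow> (\<forall>A\<in>p. A \<subseteq> S) \<and> S \<in> p \<and> {} \<notin> p \<and>
     (\<forall>A B. A \<in> p \<and> B \<in> p \<longrightarrow> A \<inter> B \<in> p) \<and>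
     (\<forall>A B. A \<in> p \<and> A \<subseteq> B \<and> B \<subseteq> S \<longrightarrow> B \<in> p) \<and>
     (\<forall>A. A \<subseteq> S \<longrightarrow> A \<in> p \<or> S - A \<in> p)"

definition betaS :: "'a set \<Rightarrow> 'a set set set" where
  "betaS S = {p. ultrafilter_on S p}"

definition beta_topology :: "'a set \<Rightarrow> 'a set set topology" where
  "beta_topology S = topology_generated_by {{p \<in> betaS S. A \<in> p} | A. A \<subseteq> S}"

text \<open>-x + A = {s \<in> S. x + s \<in> A}; A \<in> p + q iff {x. -x + A \<in> q} \<in> p.\<close>
definition beta_plus :: "'a::plus set \<Rightarrow> 'a set set \<Rightarrow> 'a set set \<Rightarrow> 'a set set" where
  "beta_plus S p q = {A. A \<subseteq> S \<and> {x \<in> S. {s \<in> S. x + s \<in> A} \<in> q} \<in> p}"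

definition two_sided_ideal :: "'a::plus set \<Rightarrow> 'a set set set \<Rightarrow> bool" where
  "two_sided_ideal S I \<longleftrightarrow> I \<subseteq> betaS S \<and>
     (\<forall>p\<in>I. \<forall>q\<in>betaS S. beta_plus S p q \<in> I \<and> beta_plus S q p \<in> I)"

definition Jp_ultra :: "'a::idom set \<Rightarrow> 'a set set set" where
  "Jp_ultra S = {p \<in> betaS S. \<forall>X\<in>p. Jp_set S X}"

end

theory Submission
  imports Defs
begin

(*
  Compactness: beta S is compact, because an open cover without a finite subcover leaves
  the complements of the basic sets inside the cover with the finite intersection property,
  and an ultrafilter extending them (Zorn) lies in no member of the cover. The set Jp_ultra S
  is closed in beta S: an ultrafilter having a member X that is not a J_p-set has the whole
  basic neighbourhood of X outside Jp_ultra S.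

  Ideal property: the configurations S_{R,L}(a,H) are finite and S_{R,L}(a,H) + s equals
  S_{R,L}(a+s,H), so X is a J_p-set as soon as every finite subset of some J_p-set B has a
  translate F + s inside X. For X in p + q take B = {x. -x + X in q}, which lies in p, and s
  in the intersection of the finitely many sets -y + X in q (y in F); for X in q + p some
  -x + X lies in p and s = x works.
*)

lemma ultrafilter_onD:
  assumes "ultrafilter_on S p"
  shows ultrafilter_on_subset: "\<And>A. A \<in> p \<Longrightarrow> A \<subseteq> S"
    and ultrafilter_on_top: "S \<in> p"
    and ultrafilter_on_empty: "{} \<notin> p"
    and ultrafilter_on_Int: "\<And>A B. A \<in> p \<Longrightarrow> B \<in> p \<Longrightarrow> A \<inter> B \<in> p"
    and ultrafilter_on_mono: "\<And>A B. A \<in> p \<Longrightarrow> A \<subseteq> B \<Longrightarrow> B \<subseteq> S \<Longrightarrow> B \<in> p"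
    and ultrafilter_on_cases: "\<And>A. A \<subseteq> S \<Longrightarrow> A \<in> p \<or> S - A \<in> p"
  using assms unfolding ultrafilter_on_def by meson+

lemma ultrafilter_on_nonempty: "ultrafilter_on S p \<Longrightarrow> A \<in> p \<Longrightarrow> A \<noteq> {}"
  using ultrafilter_on_empty by blast

lemma ultrafilter_on_Int_iff:
  assumes "ultrafilter_on S p" "A \<subseteq> S" "B \<subseteq> S"
  shows "A \<inter> B \<in> p \<longleftrightarrow> A \<in> p \<and> B \<in> p"
  using ultrafilter_on_Int[OF assms(1)] ultrafilter_on_mono[OF assms(1)] assms(2,3)
  by (meson Int_lower1 Int_lower2)

lemma ultrafilter_on_Diff_iff:
  assumes "ultrafilter_on S p" "A \<subseteq> S"
  shows "S - A \<in> p \<longleftrightarrow> A \<notin> p"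
  using ultrafilter_on_cases[OF assms] ultrafilter_on_Int[OF assms(1), of A "S - A"]
    ultrafilter_on_empty[OF assms(1)]
  by (metis Diff_disjoint)

lemma ultrafilter_on_Inter:
  assumes "ultrafilter_on S p" "finite E" "E \<subseteq> p"
  shows "S \<inter> \<Inter>E \<in> p"
  using assms(2,3)
proof (induction E rule: finite_induct)
  case empty
  then show ?case using ultrafilter_on_top[OF assms(1)] by simp
next
  case (insert A E)
  then have "A \<inter> (S \<inter> \<Inter>E) \<in> p"
    using ultrafilter_on_Int[OF assms(1)] by simp
  then show ?case by (simp add: Int_left_commute)
qed

lemma ultrafilter_on_Union:
  assumes "ultrafilter_on S p" "finite F" "F \<subseteq> Pow S" "S \<subseteq> \<Union>F"
  shows "\<exists>A\<in>F. A \<in> p"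
proof (rule ccontr)
  assume "\<not> (\<exists>A\<in>F. A \<in> p)"
  then have "(\<lambda>A. S - A) ` F \<subseteq> p"
    using assms(3) ultrafilter_on_Diff_iff[OF assms(1)] by auto
  with assms(2) have "S \<inter> \<Inter>((\<lambda>A. S - A) ` F) \<in> p"
    by (intro ultrafilter_on_Inter[OF assms(1)]) simp_all
  moreover have "S \<inter> \<Inter>((\<lambda>A. S - A) ` F) = {}"
    using assms(4) by auto
  ultimately show False
    using ultrafilter_on_empty[OF assms(1)] by simp
qed

definition fip_on :: "'a set \<Rightarrow> 'a set set \<Rightarrow> bool" where
  "fip_on S G \<longleftrightarrow> (\<forall>E. finite E \<and> E \<subseteq> G \<longrightarrow> S \<inter> \<Inter>E \<noteq> {})"

lemma fip_on_insert_iff: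
  "fip_on S (insert X G) \<longleftrightarrow> (\<forall>E. finite E \<and> E \<subseteq> G \<longrightarrow> S \<inter> \<Inter>E \<inter> X \<noteq> {})"
proof
  assume "fip_on S (insert X G)"
  then show "\<forall>E. finite E \<and> E \<subseteq> G \<longrightarrow> S \<inter> \<Inter>E \<inter> X \<noteq> {}"
    unfolding fip_on_def
  proof (intro allI impI)
    fix E assume "finite E \<and> E \<subseteq> G"
    then have "S \<inter> \<Inter>(insert X E) \<noteq> {}"
      using \<open>fip_on S (insert X G)\<close> unfolding fip_on_def by blast
    then show "S \<inter> \<Inter>E \<inter> X \<noteq> {}"
      by (simp add: Int_ac)
  qed
next
  assume *: "\<forall>E. finite E \<and> E \<subseteq> G \<longrightarrow> S \<inter> \<Inter>E \<inter> X \<noteq> {}"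
  show "fip_on S (insert X G)"
    unfolding fip_on_def
  proof (intro allI impI)
    fix E assume E: "finite E \<and> E \<subseteq> insert X G"
    then have "S \<inter> \<Inter>(E - {X}) \<inter> X \<noteq> {}"
      using * by blast
    moreover have "S \<inter> \<Inter>(E - {X}) \<inter> X \<subseteq> S \<inter> \<Inter>E"
      by blast
    ultimately show "S \<inter> \<Inter>E \<noteq> {}"
      by blast
  qed
qed

lemma maximal_fip_imp_ultrafilter_on:
  assumes "M \<subseteq> Pow S" "fip_on S M"
    and maximal: "\<And>X. X \<subseteq> S \<Longrightarrow> fip_on S (insert X M) \<Longrightarrow> X \<in> M"
  shows "ultrafilter_on S M"
proof -
  have fip: "S \<inter> \<Inter>E \<noteq> {}" if "finite E" "E \<subseteq> M" for E
    using assms(2) that unfolding fip_on_def by blast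
  have add: "X \<in> M" if "X \<subseteq> S" "\<And>E. finite E \<Longrightarrow> E \<subseteq> M \<Longrightarrow> S \<inter> \<Inter>E \<inter> X \<noteq> {}" for X
    using that by (intro maximal) (auto simp: fip_on_insert_iff)
  show ?thesis
    unfolding ultrafilter_on_def
  proof (intro conjI allI impI ballI)
    show "A \<subseteq> S" if "A \<in> M" for A
      using assms(1) that by blast
    show "S \<in> M"
      by (rule add) (use fip in auto)
    show "{} \<notin> M"
      using fip[of "{{}}"] by auto
  next
    fix A B assume AB: "A \<in> M \<and> B \<in> M"
    show "A \<inter> B \<in> M"
    proof (rule add)
      fix E assume "finite E" "E \<subseteq> M"
      then have "S \<inter> \<Inter>(insert A (insert B E)) \<noteq> {}"
        using AB by (intro fip) auto
      then show "S \<inter> \<Inter>E \<inter> (A \<inter> B) \<noteq> {}"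
        by (simp add: Int_ac)
    qed (use AB assms(1) in blast)
  next
    fix A B assume AB: "A \<in> M \<and> A \<subseteq> B \<and> B \<subseteq> S"
    show "B \<in> M"
    proof (rule add)
      fix E assume "finite E" "E \<subseteq> M"
      then have "S \<inter> \<Inter>(insert A E) \<noteq> {}"
        using AB by (intro fip) auto
      moreover have "S \<inter> \<Inter>(insert A E) \<subseteq> S \<inter> \<Inter>E \<inter> B"
        using AB by auto
      ultimately show "S \<inter> \<Inter>E \<inter> B \<noteq> {}"
        by (metis subset_empty)
    qed (use AB in blast)
  next
    fix A assume A: "A \<subseteq> S"
    show "A \<in> M \<or> S - A \<in> M"
    proof (rule ccontr)
      assume "\<not> (A \<in> M \<or> S - A \<in> M)"
      then obtain E1 E2 where "finite E1" "E1 \<subseteq> M" "S \<inter> \<Inter>E1 \<inter> A = {}"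
        and "finite E2" "E2 \<subseteq> M" "S \<inter> \<Inter>E2 \<inter> (S - A) = {}"
        using add[of A] add[of "S - A"] A by (metis Diff_subset)
      then have "S \<inter> \<Inter>(E1 \<union> E2) = {}"
        by blast
      with fip[of "E1 \<union> E2"] show False
        using \<open>finite E1\<close> \<open>finite E2\<close> \<open>E1 \<subseteq> M\<close> \<open>E2 \<subseteq> M\<close> by simp
    qed
  qed
qed

lemma fip_on_Union_chain:
  assumes "C \<noteq> {}" "subset.chain \<A> C" "\<And>F. F \<in> C \<Longrightarrow> fip_on S F"
  shows "fip_on S (\<Union>C)"
  unfolding fip_on_def
proof (intro allI impI)
  fix E assume E: "finite E \<and> E \<subseteq> \<Union>C"
  then obtain F where "F \<in> C" "E \<subseteq> F"
    using finite_subset_Union_chain[OF _ _ assms(1,2), of E] by blast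
  with assms(3) E show "S \<inter> \<Inter>E \<noteq> {}"
    unfolding fip_on_def by blast
qed

lemma ultrafilter_on_extend:
  assumes "G \<subseteq> Pow S" "fip_on S G"
  obtains q where "ultrafilter_on S q" "G \<subseteq> q"
proof -
  let ?\<F> = "{F. G \<subseteq> F \<and> F \<subseteq> Pow S \<and> fip_on S F}"
  have "\<forall>C\<in>chains ?\<F>. \<exists>U\<in>?\<F>. \<forall>F\<in>C. F \<subseteq> U"
  proof
    fix C assume C: "C \<in> chains ?\<F>"
    show "\<exists>U\<in>?\<F>. \<forall>F\<in>C. F \<subseteq> U"
    proof (cases "C = {}")
      case True
      then show ?thesis
        using assms by blast
    next
      case False
      have "fip_on S (\<Union>C)"
      proof (rule fip_on_Union_chain[OF False])
        show "subset.chain ?\<F> C"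
          using C by (simp add: chains_alt_def)
        show "fip_on S F" if "F \<in> C" for F
          using that C unfolding chains_def by blast
      qed
      moreover have "G \<subseteq> \<Union>C" "\<Union>C \<subseteq> Pow S"
        using C False unfolding chains_def by blast+
      ultimately show ?thesis
        by blast
    qed
  qed
  from Zorn_Lemma2[OF this] obtain M
    where M: "M \<in> ?\<F>" and max: "\<forall>F\<in>?\<F>. M \<subseteq> F \<longrightarrow> F = M"
    by blast
  have "ultrafilter_on S M"
  proof (rule maximal_fip_imp_ultrafilter_on)
    show "M \<subseteq> Pow S" "fip_on S M"
      using M by blast+
    show "X \<in> M" if "X \<subseteq> S" "fip_on S (insert X M)" for X
      using max[rule_format, of "insert X M"] M that by blast
  qed
  with M show thesis
    using that by blast
qed

lemma ultrafilter_on_avoiding: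
  assumes "\<A> \<subseteq> Pow S" "\<And>F. finite F \<Longrightarrow> F \<subseteq> \<A> \<Longrightarrow> \<not> S \<subseteq> \<Union>F"
  obtains q where "ultrafilter_on S q" "\<A> \<inter> q = {}"
proof -
  have "fip_on S ((\<lambda>A. S - A) ` \<A>)"
    unfolding fip_on_def
  proof (intro allI impI)
    fix E assume "finite E \<and> E \<subseteq> (\<lambda>A. S - A) ` \<A>"
    then obtain F where "F \<subseteq> \<A>" "finite F" "E = (\<lambda>A. S - A) ` F"
      by (meson finite_subset_image)
    then show "S \<inter> \<Inter>E \<noteq> {}"
      using assms(2) by auto
  qed
  then obtain q where q: "ultrafilter_on S q" "(\<lambda>A. S - A) ` \<A> \<subseteq> q"
    by (rule ultrafilter_on_extend[rotated]) auto
  have "A \<notin> q" if "A \<in> \<A>" for A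
    using that q(2) assms(1) ultrafilter_on_Diff_iff[OF q(1), of A] by blast
  with q(1) show thesis
    using that by blast
qed

abbreviation beta_basic :: "'a set \<Rightarrow> 'a set \<Rightarrow> 'a set set set" where
  "beta_basic S A \<equiv> {p \<in> betaS S. A \<in> p}"

lemma topspace_beta_topology: "topspace (beta_topology S) = betaS S"
proof -
  have "beta_basic S S = betaS S"
    unfolding betaS_def by (auto intro: ultrafilter_on_top)
  then show ?thesis
    unfolding beta_topology_def topology_generated_by_topspace by blast
qed

lemma openin_beta_basic: "A \<subseteq> S \<Longrightarrow> openin (beta_topology S) (beta_basic S A)"
  unfolding beta_topology_def by (rule topology_generated_by_Basis) blast

lemma generate_topology_on_nbhd_base:
  assumes "generate_topology_on \<B> U" "x \<in> U"
    and Int_closed: "\<And>B C y. B \<in> \<B> \<Longrightarrow> C \<in> \<B> \<Longrightarrow> y \<in> B \<inter> C \<Longrightarrow>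
      \<exists>D\<in>\<B>. y \<in> D \<and> D \<subseteq> B \<inter> C"
  shows "\<exists>B\<in>\<B>. x \<in> B \<and> B \<subseteq> U"
  using assms(1,2)
proof (induction arbitrary: x)
  case Empty
  then show ?case by simp
next
  case (Int a b)
  from Int.IH(1)[of x] Int.prems obtain B where "B \<in> \<B>" "x \<in> B" "B \<subseteq> a"
    by blast
  moreover from Int.IH(2)[of x] Int.prems obtain C where "C \<in> \<B>" "x \<in> C" "C \<subseteq> b"
    by blast
  ultimately obtain D where "D \<in> \<B>" "x \<in> D" "D \<subseteq> B \<inter> C"
    using Int_closed[of B C x] by blast
  with \<open>B \<subseteq> a\<close> \<open>C \<subseteq> b\<close> show ?case
    by blast
next
  case (UN K)
  then obtain k where "k \<in> K" "x \<in> k"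
    by blast
  with UN.IH[of k x] show ?case
    by blast
next
  case (Basis s)
  then show ?case by blast
qed

lemma openin_beta_topology_nbhd:
  assumes "openin (beta_topology S) U" "p \<in> U"
  obtains A where "A \<subseteq> S" "A \<in> p" "beta_basic S A \<subseteq> U"
proof -
  have "\<exists>B\<in>{beta_basic S A | A. A \<subseteq> S}. p \<in> B \<and> B \<subseteq> U"
  proof (rule generate_topology_on_nbhd_base)
    show "generate_topology_on {beta_basic S A | A. A \<subseteq> S} U"
      using assms(1) unfolding beta_topology_def openin_topology_generated_by_iff .
    show "p \<in> U" by fact
  next
    fix B C q assume "B \<in> {beta_basic S A | A. A \<subseteq> S}" "C \<in> {beta_basic S A | A. A \<subseteq> S}"
      and q: "q \<in> B \<inter> C"
    then obtain A A' where "A \<subseteq> S" "A' \<subseteq> S" "B = beta_basic S A" "C = beta_basic S A'"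
      by blast
    moreover from this have "beta_basic S (A \<inter> A') = B \<inter> C"
      unfolding betaS_def by (auto simp: ultrafilter_on_Int_iff)
    ultimately show "\<exists>D\<in>{beta_basic S A | A. A \<subseteq> S}. q \<in> D \<and> D \<subseteq> B \<inter> C"
      using q by (intro bexI[of _ "beta_basic S (A \<inter> A')"]) auto
  qed
  then show thesis
    using that by blast
qed

lemma compact_space_beta_topology: "compact_space (beta_topology S)"
  unfolding compact_space_alt topspace_beta_topology
proof (intro allI impI)
  fix \<U> assume \<U>: "(\<forall>U\<in>\<U>. openin (beta_topology S) U) \<and> betaS S \<subseteq> \<Union>\<U>"
  define \<A> where "\<A> = {A. A \<subseteq> S \<and> (\<exists>U\<in>\<U>. beta_basic S A \<subseteq> U)}"
  show "\<exists>\<F>. finite \<F> \<and> \<F> \<subseteq> \<U> \<and> betaS S \<subseteq> \<Union>\<F>"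
  proof (cases "\<exists>F. finite F \<and> F \<subseteq> \<A> \<and> S \<subseteq> \<Union>F")
    case True
    then obtain F where F: "finite F" "F \<subseteq> \<A>" "S \<subseteq> \<Union>F"
      by blast
    then have "\<forall>A\<in>F. \<exists>U. U \<in> \<U> \<and> beta_basic S A \<subseteq> U"
      unfolding \<A>_def by blast
    then obtain u where u: "\<forall>A\<in>F. u A \<in> \<U> \<and> beta_basic S A \<subseteq> u A"
      by (rule bchoice[THEN exE])
    have "betaS S \<subseteq> \<Union>(u ` F)"
    proof
      fix p assume p: "p \<in> betaS S"
      moreover have "F \<subseteq> Pow S"
        using F(2) unfolding \<A>_def by blast
      ultimately obtain A where "A \<in> F" "A \<in> p"
        using ultrafilter_on_Union[of S p F] F unfolding betaS_def by blast
      then show "p \<in> \<Union>(u ` F)"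
        using u p by blast
    qed
    then show ?thesis
      using F(1) u by blast
  next
    case False
    have "\<A> \<subseteq> Pow S"
      unfolding \<A>_def by blast
    moreover have "\<not> S \<subseteq> \<Union>F" if "finite F" "F \<subseteq> \<A>" for F
      using False that by blast
    ultimately obtain q where q: "ultrafilter_on S q" "\<A> \<inter> q = {}"
      by (rule ultrafilter_on_avoiding)
    then obtain U where "U \<in> \<U>" "q \<in> U"
      using \<U> unfolding betaS_def by blast
    then obtain A where A: "A \<subseteq> S" "A \<in> q" "beta_basic S A \<subseteq> U"
      using \<U> openin_beta_topology_nbhd by metis
    with \<open>U \<in> \<U>\<close> have "A \<in> \<A>"
      unfolding \<A>_def by blast
    with q(2) A(2) show ?thesis
      by blast
  qed
qed

lemma closedin_beta_topology_all_members:
  "closedin (beta_topology S) {p \<in> betaS S. \<forall>X\<in>p. P X}"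
proof -
  have "betaS S - {p \<in> betaS S. \<forall>X\<in>p. P X} = \<Union>{beta_basic S X | X. X \<subseteq> S \<and> \<not> P X}"
  proof (intro equalityI subsetI)
    fix p assume "p \<in> betaS S - {p \<in> betaS S. \<forall>X\<in>p. P X}"
    then obtain X where X: "p \<in> betaS S" "X \<in> p" "\<not> P X"
      by blast
    moreover from X have "X \<subseteq> S"
      unfolding betaS_def using ultrafilter_on_subset by blast
    ultimately show "p \<in> \<Union>{beta_basic S X | X. X \<subseteq> S \<and> \<not> P X}"
      by blast
  qed blast
  moreover have "openin (beta_topology S) (\<Union>{beta_basic S X | X. X \<subseteq> S \<and> \<not> P X})"
    by (rule openin_Union) (auto intro: openin_beta_basic)
  ultimately show ?thesis
    unfolding closedin_def topspace_beta_topology by auto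
qed

lemma compactin_Jp_ultra: "compactin (beta_topology S) (Jp_ultra S)"
  unfolding Jp_ultra_def
  by (rule closed_compactin[OF compact_space_beta_topology[unfolded compact_space_def]])
    (auto simp: topspace_beta_topology intro: closedin_beta_topology_all_members)

definition shifts_in :: "'a::plus set \<Rightarrow> 'a set set \<Rightarrow> 'a set \<Rightarrow> 'a set" where
  "shifts_in S q A = {x \<in> S. {s \<in> S. x + s \<in> A} \<in> q}"

lemma beta_plus_iff: "A \<in> beta_plus S p q \<longleftrightarrow> A \<subseteq> S \<and> shifts_in S q A \<in> p"
  unfolding beta_plus_def shifts_in_def by simp

lemma shifts_in_subset: "shifts_in S q A \<subseteq> S"
  unfolding shifts_in_def by blast

lemma shifts_in_empty:
  assumes "ultrafilter_on S q"
  shows "shifts_in S q {} = {}"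
  unfolding shifts_in_def using ultrafilter_on_empty[OF assms] by simp

lemma shifts_in_Int:
  assumes "ultrafilter_on S q"
  shows "shifts_in S q (A \<inter> B) = shifts_in S q A \<inter> shifts_in S q B"
proof -
  have "{s \<in> S. x + s \<in> A \<inter> B} = {s \<in> S. x + s \<in> A} \<inter> {s \<in> S. x + s \<in> B}" for x
    by blast
  then show ?thesis
    unfolding shifts_in_def by (auto simp: ultrafilter_on_Int_iff[OF assms] Collect_restrict)
qed

lemma shifts_in_Diff:
  assumes "\<forall>a\<in>S. \<forall>b\<in>S. a + b \<in> S" "ultrafilter_on S q"
  shows "shifts_in S q (S - A) = S - shifts_in S q A"
proof -
  have "{s \<in> S. x + s \<in> S - A} = S - {s \<in> S. x + s \<in> A}" if "x \<in> S" for x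
    using assms(1) that by blast
  then show ?thesis
    unfolding shifts_in_def by (auto simp: ultrafilter_on_Diff_iff[OF assms(2)] Collect_restrict)
qed

lemma ultrafilter_on_beta_plus:
  assumes add: "\<forall>a\<in>S. \<forall>b\<in>S. a + b \<in> S"
    and p: "ultrafilter_on S p" and q: "ultrafilter_on S q"
  shows "ultrafilter_on S (beta_plus S p q)"
  unfolding ultrafilter_on_def
proof (intro conjI allI impI ballI)
  show "A \<subseteq> S" if "A \<in> beta_plus S p q" for A
    using that by (simp add: beta_plus_iff)
  have "shifts_in S q S = S"
    using shifts_in_Diff[OF add q, of "{}"] shifts_in_empty[OF q] by simp
  then show "S \<in> beta_plus S p q"
    using ultrafilter_on_top[OF p] by (simp add: beta_plus_iff)
  show "{} \<notin> beta_plus S p q"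
    using shifts_in_empty[OF q] ultrafilter_on_empty[OF p] by (simp add: beta_plus_iff)
next
  fix A B assume "A \<in> beta_plus S p q \<and> B \<in> beta_plus S p q"
  then show "A \<inter> B \<in> beta_plus S p q"
    using shifts_in_Int[OF q] ultrafilter_on_Int[OF p] by (auto simp: beta_plus_iff)
next
  fix A B assume AB: "A \<in> beta_plus S p q \<and> A \<subseteq> B \<and> B \<subseteq> S"
  then have "shifts_in S q A \<in> p" "shifts_in S q A \<subseteq> shifts_in S q B"
    using shifts_in_Int[OF q, of A B] by (auto simp: beta_plus_iff Int_absorb2)
  then have "shifts_in S q B \<in> p"
    using ultrafilter_on_mono[OF p] shifts_in_subset by blast
  with AB show "B \<in> beta_plus S p q"
    by (simp add: beta_plus_iff)
next
  fix A assume "A \<subseteq> S"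
  then show "A \<in> beta_plus S p q \<or> S - A \<in> beta_plus S p q"
    using shifts_in_Diff[OF add q] ultrafilter_on_cases[OF p shifts_in_subset]
    by (auto simp: beta_plus_iff)
qed

lemma SRL_translate: "SRL R L (a + s) H = (\<lambda>y. y + s) ` SRL R L a H"
  unfolding SRL_def by (force simp: add_ac)

lemma finite_SRL:
  assumes "finite R" "finite L"
  shows "finite (SRL R L a H)"
proof -
  have "SRL R L a H = (\<lambda>(f, g). a + poly f (\<Sum>t\<in>H. g t)) ` (R \<times> L)"
    unfolding SRL_def by force
  then show ?thesis
    using assms by simp
qed

lemma Jp_set_from_translates:
  fixes S :: "'a::idom set"
  assumes add: "\<forall>a\<in>S. \<forall>b\<in>S. a + b \<in> S" and "X \<subseteq> S" "Jp_set S B"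
    and translate: "\<And>F. finite F \<Longrightarrow> F \<subseteq> B \<Longrightarrow> \<exists>s\<in>S. (\<lambda>y. y + s) ` F \<subseteq> X"
  shows "Jp_set S X"
  unfolding Jp_set_def
proof (intro conjI allI impI)
  show "X \<subseteq> S" by fact
  fix R :: "'a poly set" and L :: "(nat \<Rightarrow> 'a) set"
  assume RL: "finite R \<and> R \<noteq> {} \<and> R \<subseteq> integral_polys \<and> finite L \<and> L \<noteq> {} \<and> L \<subseteq> seqs_in S"
  then obtain a H where aH: "a \<in> S" "finite H" "H \<noteq> {}" "H \<subseteq> {1..}" "SRL R L a H \<subseteq> B"
    using \<open>Jp_set S B\<close> unfolding Jp_set_def by meson
  moreover have "finite (SRL R L a H)"
    using RL by (intro finite_SRL) auto
  with translate aH(5) obtain s where "s \<in> S" "(\<lambda>y. y + s) ` SRL R L a H \<subseteq> X"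
    by blast
  ultimately show "\<exists>a\<in>S. \<exists>H. finite H \<and> H \<noteq> {} \<and> H \<subseteq> {1..} \<and> SRL R L a H \<subseteq> X"
    using add by (intro bexI[of _ "a + s"] exI[of _ H]) (simp_all add: SRL_translate)
qed

lemma beta_plus_Jp_ultra_left:
  assumes add: "\<forall>a\<in>S. \<forall>b\<in>S. a + b \<in> S" and "p \<in> Jp_ultra S" "q \<in> betaS S"
  shows "beta_plus S p q \<in> Jp_ultra S"
proof -
  have p: "ultrafilter_on S p" "\<forall>X\<in>p. Jp_set S X" and q: "ultrafilter_on S q"
    using assms(2,3) unfolding Jp_ultra_def betaS_def by auto
  have "Jp_set S X" if X: "X \<in> beta_plus S p q" for X
  proof (rule Jp_set_from_translates[OF add])
    show "X \<subseteq> S" "Jp_set S (shifts_in S q X)"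
      using X p(2) unfolding beta_plus_iff by blast+
    fix F assume "finite F" "F \<subseteq> shifts_in S q X"
    then have "S \<inter> \<Inter>((\<lambda>y. {s \<in> S. y + s \<in> X}) ` F) \<in> q"
      by (intro ultrafilter_on_Inter[OF q]) (auto simp: shifts_in_def)
    then have "S \<inter> \<Inter>((\<lambda>y. {s \<in> S. y + s \<in> X}) ` F) \<noteq> {}"
      by (rule ultrafilter_on_nonempty[OF q])
    then show "\<exists>s\<in>S. (\<lambda>y. y + s) ` F \<subseteq> X"
      by blast
  qed
  then show ?thesis
    using ultrafilter_on_beta_plus[OF add p(1) q] unfolding Jp_ultra_def betaS_def by blast
qed

lemma beta_plus_Jp_ultra_right:
  assumes add: "\<forall>a\<in>S. \<forall>b\<in>S. a + b \<in> S" and "p \<in> Jp_ultra S" "q \<in> betaS S"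
  shows "beta_plus S q p \<in> Jp_ultra S"
proof -
  have p: "ultrafilter_on S p" "\<forall>X\<in>p. Jp_set S X" and q: "ultrafilter_on S q"
    using assms(2,3) unfolding Jp_ultra_def betaS_def by auto
  have "Jp_set S X" if X: "X \<in> beta_plus S q p" for X
  proof -
    have "shifts_in S p X \<noteq> {}"
      using X ultrafilter_on_nonempty[OF q] unfolding beta_plus_iff by blast
    then obtain x where x: "x \<in> S" "{s \<in> S. x + s \<in> X} \<in> p"
      unfolding shifts_in_def by blast
    show ?thesis
    proof (rule Jp_set_from_translates[OF add])
      show "X \<subseteq> S"
        using X unfolding beta_plus_iff by blast
      show "Jp_set S {s \<in> S. x + s \<in> X}"
        using x(2) p(2) by blast
      show "\<exists>s\<in>S. (\<lambda>y. y + s) ` F \<subseteq> X" if "finite F" "F \<subseteq> {s \<in> S. x + s \<in> X}" for F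
        using that x by (intro bexI[of _ x] image_subsetI) (auto simp: add.commute)
    qed
  qed
  then show ?thesis
    using ultrafilter_on_beta_plus[OF add q p(1)] unfolding Jp_ultra_def betaS_def by blast
qed

lemma two_sided_ideal_Jp_ultra:
  assumes "\<forall>a\<in>S. \<forall>b\<in>S. a + b \<in> S"
  shows "two_sided_ideal S (Jp_ultra S)"
  unfolding two_sided_ideal_def
proof (intro conjI ballI)
  show "Jp_ultra S \<subseteq> betaS S"
    unfolding Jp_ultra_def by blast
  fix p q assume "p \<in> Jp_ultra S" "q \<in> betaS S"
  then show "beta_plus S p q \<in> Jp_ultra S" "beta_plus S q p \<in> Jp_ultra S"
    using beta_plus_Jp_ultra_left[OF assms] beta_plus_Jp_ultra_right[OF assms] by blast+
qed

theorem lemma5p1: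
  fixes S :: "'a::idom set"
  assumes "\<forall>a\<in>S. \<forall>b\<in>S. a + b \<in> S"
    and "diff_set S = UNIV"
    and "0 \<notin> S"
  shows "compactin (beta_topology S) (Jp_ultra S) \<and> two_sided_ideal S (Jp_ultra S)"
  using compactin_Jp_ultra two_sided_ideal_Jp_ultra[OF assms(1)] by blast

end
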